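(* Let $I=[0,1]$ be equipped with a metric $\varrho$ compatible with the Euclidean topology, let $f\colon I\to I$ be continuous, and let $x\in I$ be such that $\omega_f(x)$ is finite. Then, for every $m\in\mathbb{N}$ and all but finitely many $\varepsilon>0$, $$\underline{c}_m(x,\varepsilon)=\overline{c}_m(x,\varepsilon).$$ More precisely, if $\omega_f(x)=\{y_0,y_1,\dots,y_{p-1}\}$ has exactly $p$ elements and $$0<\varepsilon\notin\{\varrho_m(y_i,y_j):0\le i,j<p\},$$ then the asymptotic correlation sum $c_m(x,\varepsilon)=\lim_{n\to\infty}C_m(x,n,\varepsilon)$ exists and $$c_m(x,\varepsilon)=\frac1{p^2}\#\{(i,j)\in\{0,\dots,p-1\}^2:\ \varrho_m(y_i,y_j)\le\varepsilon\}.$$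
   Context: $\mathbb{N}=\{1,2,\dots\}$. For $m\in\mathbb{N}$, Bowen's metric is $\varrho_m(x,y)=\max\{\varrho(f^i(x),f^i(y)):0\le i<m\}$. For $x\in I$, $n\in\mathbb{N}$, $\varepsilon>0$, the correlation sum is $$C_m(x,n,\varepsilon)=\frac1{n^2}\#\{(i,j):0\le i,j<n,\ \varrho_m(f^i(x),f^j(x))\le\varepsilon\},$$ and $\underline{c}_m(x,\varepsilon)=\liminf_{n\to\infty}C_m(x,n,\varepsilon)$, $\overline{c}_m(x,\varepsilon)=\limsup_{n\to\infty}C_m(x,n,\varepsilon)$. $\omega_f(x)$ is the set of all limit points of the trajectory $(f^n(x))_{n\ge0}$. *)

theory Defs
  imports "HOL-Analysis.Analysis"
begin

definition bowen_metric ::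
    "('a \<Rightarrow> 'a \<Rightarrow> real) \<Rightarrow> ('a \<Rightarrow> 'a) \<Rightarrow> nat \<Rightarrow> 'a \<Rightarrow> 'a \<Rightarrow> real" where
  "bowen_metric \<rho> f m x y = Max {\<rho> ((f ^^ i) x) ((f ^^ i) y) | i. i < m}"

definition corr_sum ::
    "('a \<Rightarrow> 'a \<Rightarrow> real) \<Rightarrow> ('a \<Rightarrow> 'a) \<Rightarrow> nat \<Rightarrow> 'a \<Rightarrow> nat \<Rightarrow> real \<Rightarrow> real" where
  "corr_sum \<rho> f m x n \<epsilon> =
     1 / (real n)\<^sup>2 *
     real (card {(i, j). i < n \<and> j < n \<and> bowen_metric \<rho> f m ((f ^^ i) x) ((f ^^ j) x) \<le> \<epsilon>})"

definition lower_corr ::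
    "('a \<Rightarrow> 'a \<Rightarrow> real) \<Rightarrow> ('a \<Rightarrow> 'a) \<Rightarrow> nat \<Rightarrow> 'a \<Rightarrow> real \<Rightarrow> ereal" where
  "lower_corr \<rho> f m x \<epsilon> = liminf (\<lambda>n. ereal (corr_sum \<rho> f m x n \<epsilon>))"

definition upper_corr ::
    "('a \<Rightarrow> 'a \<Rightarrow> real) \<Rightarrow> ('a \<Rightarrow> 'a) \<Rightarrow> nat \<Rightarrow> 'a \<Rightarrow> real \<Rightarrow> ereal" where
  "upper_corr \<rho> f m x \<epsilon> = limsup (\<lambda>n. ereal (corr_sum \<rho> f m x n \<epsilon>))"

text \<open>Limit points of the trajectory as a sequence (not accumulation points of its range):
  a value attained infinitely often is a limit point.\<close>

definition omega_limit :: "('a::topological_space \<Rightarrow> 'a) \<Rightarrow> 'a \<Rightarrow> 'a set" where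
  "omega_limit f x = {y. \<exists>r::nat \<Rightarrow> nat. strict_mono r \<and> (\<lambda>n. (f ^^ r n) x) \<longlonglongrightarrow> y}"

end

theory Submission
  imports Defs
begin

text \<open>Replace the points of the orbit by nearest points \<open>w n\<close> of the finite set \<open>\<omega>\<^sub>f(x)\<close>. By uniform
  continuity \<open>w\<close> is eventually an \<open>f\<close>-orbit, and it visits every point of \<open>\<omega>\<^sub>f(x)\<close> infinitely often, so
  \<open>f\<close> permutes \<open>\<omega>\<^sub>f(x)\<close> cyclically and the visits of \<open>w\<close> are equidistributed. As \<open>\<epsilon>\<close> is not one of the
  finitely many Bowen distances between limit points, replacing the orbit by \<open>w\<close> changes only
  \<open>O(n)\<close> of the \<open>n\<^sup>2\<close> comparisons.\<close>

section \<open>Asymptotic sequences in a finite set\<close>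

text \<open>Distances within a finite set take finitely many values, so the nonzero ones are bounded
  below by some \<open>d > 0\<close>. A distance that drops below \<open>d\<close> is therefore
  exactly 0. This turns asymptotic statements about \<open>w\<close> into exact ones.\<close>

lemma finite_eventually_eq:
  fixes u v :: "nat \<Rightarrow> 'a::metric_space"
  assumes "finite W" "eventually (\<lambda>n. u n \<in> W) F" "eventually (\<lambda>n. v n \<in> W) F"
    and lim: "((\<lambda>n. dist (u n) (v n)) \<longlongrightarrow> 0) F"
  shows "eventually (\<lambda>n. u n = v n) F"
proof -
  have finD: "finite {dist a b | a b. a \<in> W \<and> b \<in> W}"
    by (rule finite_image_set2) (simp_all add: assms(1))
  then obtain d where d: "d > 0" "\<And>t. t \<in> {dist a b | a b. a \<in> W \<and> b \<in> W} \<Longrightarrow> t \<noteq> 0 \<Longrightarrow> d \<le> dist 0 t"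
    using finite_set_avoid[OF finD, of 0] by blast
  have "eventually (\<lambda>n. dist (u n) (v n) < d) F"
    using order_tendstoD(2)[OF lim d(1)] .
  with assms(2,3) show ?thesis
  proof eventually_elim
    case (elim n)
    show ?case
    proof (rule ccontr)
      assume "u n \<noteq> v n"
      then have "d \<le> dist 0 (dist (u n) (v n))"
        using elim by (intro d(2)) auto
      then show False using elim by simp
    qed
  qed
qed

lemma dist_tendsto_0_trans:
  assumes "((\<lambda>n. dist (u n) (v n)) \<longlongrightarrow> 0) F" "((\<lambda>n. dist (u n) (v' n)) \<longlongrightarrow> 0) F"
  shows "((\<lambda>n. dist (v n) (v' n)) \<longlongrightarrow> 0) F"
proof (rule Lim_null_comparison)
  show "((\<lambda>n. dist (u n) (v n) + dist (u n) (v' n)) \<longlongrightarrow> 0) F"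
    using tendsto_add[OF assms] by simp
  show "\<forall>\<^sub>F n in F. norm (dist (v n) (v' n)) \<le> dist (u n) (v n) + dist (u n) (v' n)"
    by (intro always_eventually) (simp add: dist_triangle3)
qed

section \<open>The limit set and the sequence in it that tracks the orbit\<close>

lemma funpow_in:
  assumes "f \<in> S \<rightarrow> S" "x \<in> S"
  shows "(f ^^ n) x \<in> S"
  using assms by (induction n) auto

lemma omega_limit_subset:
  assumes "closed S" "f \<in> S \<rightarrow> S" "x \<in> S"
  shows "omega_limit f x \<subseteq> S"
proof
  fix y assume "y \<in> omega_limit f x"
  then obtain r where "(\<lambda>n. (f ^^ r n) x) \<longlonglongrightarrow> y" by (auto simp: omega_limit_def)
  then show "y \<in> S" by (rule closed_sequentially[OF assms(1) funpow_in[OF assms(2,3)]])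
qed

text \<open>Continuity carries convergence along the times \<open>r n\<close> over to the times
  \<open>r n + 1\<close>, so \<open>Suc \<circ> r\<close> witnesses that \<open>f y\<close> is a
  limit point.\<close>

lemma omega_limit_image:
  fixes f :: "'a::metric_space \<Rightarrow> 'a"
  assumes "closed S" "continuous_on S f" "f \<in> S \<rightarrow> S" "x \<in> S"
  shows "f ` omega_limit f x \<subseteq> omega_limit f x"
proof clarify
  fix y assume y: "y \<in> omega_limit f x"
  then obtain r where r: "strict_mono r" "(\<lambda>n. (f ^^ r n) x) \<longlonglongrightarrow> y"
    by (auto simp: omega_limit_def)
  have "y \<in> S" using y omega_limit_subset[OF assms(1,3,4)] by blast
  then have "(\<lambda>n. f ((f ^^ r n) x)) \<longlonglongrightarrow> f y"
    by (intro continuous_on_tendsto_compose[OF assms(2) r(2)]) (simp_all add: funpow_in[OF assms(3,4)])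
  then have "(\<lambda>n. (f ^^ (Suc \<circ> r) n) x) \<longlonglongrightarrow> f y" by simp
  moreover have "strict_mono (Suc \<circ> r)" using r(1) by (auto simp: strict_mono_def)
  ultimately show "f y \<in> omega_limit f x" unfolding omega_limit_def by blast
qed

text \<open>If the orbit stayed at distance at least \<open>e\<close> from the limit set at
  infinitely many times, compactness would give a convergent subsequence of these times; its limit
  is itself a limit point, which the subsequence then approaches.\<close>

lemma omega_limit_attracts:
  fixes f :: "'a::metric_space \<Rightarrow> 'a"
  assumes "compact S" "f \<in> S \<rightarrow> S" "x \<in> S" "e > 0"
  shows "eventually (\<lambda>n. \<exists>w\<in>omega_limit f x. dist ((f ^^ n) x) w < e) sequentially"
proof (rule ccontr)
  define P where "P = (\<lambda>n. \<exists>w\<in>omega_limit f x. dist ((f ^^ n) x) w < e)"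
  assume "\<not> ?thesis"
  then have inf: "infinite {n. \<not> P n}"
    by (simp add: P_def cofinite_eq_sequentially[symmetric] eventually_cofinite)
  define r where "r = enumerate {n. \<not> P n}"
  have r: "strict_mono r" "\<not> P (r n)" for n
    using inf strict_mono_enumerate enumerate_in_set[OF inf, of n] by (auto simp: r_def)
  have "\<forall>n. (f ^^ r n) x \<in> S" by (simp add: funpow_in[OF assms(2,3)])
  then obtain l s where s: "strict_mono s" "((\<lambda>n. (f ^^ r n) x) \<circ> s) \<longlonglongrightarrow> l"
    using assms(1) unfolding compact_def by metis
  have "l \<in> omega_limit f x"
    unfolding omega_limit_def using s strict_mono_o[OF r(1) s(1)]
    by (auto intro!: exI[of _ "r \<circ> s"] simp: o_def)
  moreover obtain n where "dist ((f ^^ r (s n)) x) l < e"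
    using tendstoD[OF s(2) assms(4)] by (auto simp: eventually_sequentially)
  ultimately show False using r(2) P_def by blast
qed

text \<open>Choosing a nearest limit point at each time gives a sequence asymptotic to the orbit.
  Since it lives in a finite set, its asymptotic relations with \<open>f\<close> and with convergent
  subsequences of the orbit become equalities at all late times.\<close>

lemma omega_limit_tracking:
  fixes f :: "'a::metric_space \<Rightarrow> 'a"
  assumes S: "compact S" "continuous_on S f" "f \<in> S \<rightarrow> S" "x \<in> S"
    and fin: "finite (omega_limit f x)"
  obtains w where "\<And>n. w n \<in> omega_limit f x" "(\<lambda>n. dist ((f ^^ n) x) (w n)) \<longlonglongrightarrow> 0"
    "eventually (\<lambda>n. w (Suc n) = f (w n)) sequentially"
    "\<And>a N. a \<in> omega_limit f x \<Longrightarrow> \<exists>n\<ge>N. w n = a"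
proof -
  define W where "W = omega_limit f x"
  have finW: "finite W" using fin by (simp add: W_def)
  have cl: "closed S" using S(1) by (rule compact_imp_closed)
  have WS: "W \<subseteq> S" using omega_limit_subset[OF cl S(3,4)] by (simp add: W_def)
  have fW: "f ` W \<subseteq> W" using omega_limit_image[OF cl S(2-4)] by (simp add: W_def)
  have near: "eventually (\<lambda>n. \<exists>v\<in>W. dist ((f ^^ n) x) v < e) sequentially" if "e > 0" for e
    using omega_limit_attracts[OF S(1,3,4) that] by (simp add: W_def)
  \<comment> \<open>Attraction at any scale already yields a limit point; the minimiser below needs
    one.\<close>
  have "W \<noteq> {}" using near[of 1] by (auto simp: eventually_sequentially)
  define w where "w n = arg_min_on (dist ((f ^^ n) x)) W" for n
  have w: "w n \<in> W" "\<not> (\<exists>v\<in>W. dist ((f ^^ n) x) v < dist ((f ^^ n) x) (w n))" for n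
    unfolding w_def using arg_min_if_finite[OF finW \<open>W \<noteq> {}\<close>] by blast+
  have lim: "(\<lambda>n. dist ((f ^^ n) x) (w n)) \<longlonglongrightarrow> 0"
  proof (rule tendstoI)
    fix e :: real assume "e > 0"
    from near[OF this] show "\<forall>\<^sub>F n in sequentially. dist (dist ((f ^^ n) x) (w n)) 0 < e"
    proof eventually_elim
      case (elim n)
      then obtain v where v: "v \<in> W" "dist ((f ^^ n) x) v < e" by blast
      then have "dist ((f ^^ n) x) (w n) \<le> dist ((f ^^ n) x) v" using w(2)[of n] by (simp add: not_less)
      then show ?case using v(2) by simp
    qed
  qed
  \<comment> \<open>Uniformity matters because neither the orbit nor \<open>w\<close> converges:
    they only approach each other.\<close>
  have "uniformly_continuous_on S f"
    using S(1,2) by (rule compact_uniformly_continuous[rotated])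
  then have "(\<forall>n. u n \<in> S) \<and> (\<forall>n. v n \<in> S) \<and> (\<lambda>n. dist (u n) (v n)) \<longlonglongrightarrow> 0
      \<Longrightarrow> (\<lambda>n. dist (f (u n)) (f (v n))) \<longlonglongrightarrow> 0" for u v
    unfolding uniformly_continuous_on_sequentially by blast
  from this[of "\<lambda>n. (f ^^ n) x" w] have limf: "(\<lambda>n. dist (f ((f ^^ n) x)) (f (w n))) \<longlonglongrightarrow> 0"
    using lim w(1) WS funpow_in[OF S(3,4)] by blast
  \<comment> \<open>Both \<open>w (Suc n)\<close> and \<open>f (w n)\<close> are asymptotic to the
    orbit point at time \<open>Suc n\<close>.\<close>
  have "(\<lambda>n. dist (w (Suc n)) (f (w n))) \<longlonglongrightarrow> 0"
    by (rule dist_tendsto_0_trans[OF LIMSEQ_Suc[OF lim]]) (use limf in simp)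
  then have ev: "eventually (\<lambda>n. w (Suc n) = f (w n)) sequentially"
    using finW w(1) fW by (intro finite_eventually_eq) (auto simp: image_subset_iff)
  have rec: "\<exists>n\<ge>N. w n = a" if a: "a \<in> W" for a N
  proof -
    obtain r where r: "strict_mono r" "(\<lambda>n. (f ^^ r n) x) \<longlonglongrightarrow> a"
      using a by (auto simp: W_def omega_limit_def)
    have "(\<lambda>n. dist ((f ^^ r n) x) (w (r n))) \<longlonglongrightarrow> 0"
      using LIMSEQ_subseq_LIMSEQ[OF lim r(1)] by (simp add: o_def)
    moreover have "(\<lambda>n. dist ((f ^^ r n) x) a) \<longlonglongrightarrow> 0"
      by (rule tendsto_dist_iff[THEN iffD1, OF r(2)])
    ultimately have "(\<lambda>n. dist (w (r n)) a) \<longlonglongrightarrow> 0"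
      by (rule dist_tendsto_0_trans[of "\<lambda>n. (f ^^ r n) x"])
    then have "eventually (\<lambda>n. w (r n) = a) sequentially"
      using finW w(1) a by (intro finite_eventually_eq) auto
    then obtain k where "\<And>n. n \<ge> k \<Longrightarrow> w (r n) = a" by (auto simp: eventually_sequentially)
    \<comment> \<open>The index is at least \<open>k\<close>, so the equality holds there, and at
      least \<open>N\<close>, so the time \<open>r (max k N)\<close> is late enough because
      \<open>r\<close> dominates the identity.\<close>
    moreover have "N \<le> r (max k N)" using seq_suble[OF r(1), of "max k N"] by linarith
    ultimately show ?thesis by (metis max.cobounded1)
  qed
  show thesis using that[OF w(1)[unfolded W_def] lim ev rec[unfolded W_def]] .
qed

section \<open>Equidistribution of visits along a cycle\<close>

text \<open>From time \<open>N\<close> on, \<open>Suc\<close> maps visits to \<open>a\<close>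
  injectively to visits to \<open>f a\<close>. The slack \<open>Suc N\<close> pays for the
  \<open>N\<close> initial times and for one image that may fall on time \<open>n\<close>, just
  outside the window.\<close>

lemma visit_count_le_image:
  fixes w :: "nat \<Rightarrow> 'a"
  assumes orbit: "\<And>n. n \<ge> N \<Longrightarrow> w (Suc n) = f (w n)"
  shows "card {i. i < n \<and> w i = a} \<le> card {i. i < n \<and> w i = f a} + Suc N"
proof -
  let ?A = "{i. i < n \<and> w i = a}" and ?B = "{i. i < n \<and> w i = f a}"
  have "Suc ` (?A - {..<N}) \<subseteq> insert n ?B"
    using orbit by auto
  then have "card (Suc ` (?A - {..<N})) \<le> card (insert n ?B)"
    by (intro card_mono) auto
  then have "card (?A - {..<N}) \<le> Suc (card ?B)"
    by (simp add: card_image)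
  moreover have "card ?A - card {..<N} \<le> card (?A - {..<N})"
    by (intro diff_card_le_card_Diff) auto
  ultimately show ?thesis by simp
qed

text \<open>Along a cycle the visit counts of any two points differ by a bounded amount, and they add up
  to \<open>n\<close>.\<close>

lemma visit_frequency:
  fixes w :: "nat \<Rightarrow> 'a"
  assumes fin: "finite W" and w: "\<And>n. w n \<in> W"
    and orbit: "\<And>n. n \<ge> N \<Longrightarrow> w (Suc n) = f (w n)"
    and rec: "\<And>a N. a \<in> W \<Longrightarrow> \<exists>n\<ge>N. w n = a"
    and a: "a \<in> W"
  shows "(\<lambda>n. real (card {i. i < n \<and> w i = a}) / real n) \<longlonglongrightarrow> 1 / real (card W)"
proof -
  define c where "c b n = card {i. i < n \<and> w i = b}" for b n
  have iter: "w (N' + k) = (f ^^ k) (w N')" if "N' \<ge> N" for N' k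
    using that by (induction k) (auto simp: orbit)
  \<comment> \<open>Each application of \<open>f\<close> loses at most \<open>Suc N\<close>
    visits.\<close>
  have le_iter: "c b n \<le> c ((f ^^ k) b) n + k * Suc N" for b n k
  proof (induction k)
    case (Suc k)
    then show ?case
      using visit_count_le_image[of N w f n "(f ^^ k) b"] orbit by (simp add: c_def)
  qed simp
  \<comment> \<open>Transitivity of \<open>f\<close> on \<open>W\<close>: follow \<open>w\<close>
    from a visit to \<open>b\<close> after time \<open>N\<close> to a later visit to
    \<open>b'\<close>.\<close>
  have "\<exists>k. (f ^^ k) b = b'" if "b \<in> W" "b' \<in> W" for b b'
  proof -
    obtain i where i: "i \<ge> N" "w i = b" using rec[OF \<open>b \<in> W\<close>] by blast
    obtain j where j: "j \<ge> i" "w j = b'" using rec[OF \<open>b' \<in> W\<close>] by blast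
    then show ?thesis using iter[OF i(1), of "j - i"] i(2) by auto
  qed
  then obtain k where k: "\<And>b b'. b \<in> W \<Longrightarrow> b' \<in> W \<Longrightarrow> (f ^^ k b b') b = b'" by metis
  \<comment> \<open>One bound, independent of \<open>n\<close>, for all pairs: a sum of nonnegative
    terms dominates each of them.\<close>
  define K where "K = (\<Sum>b\<in>W. \<Sum>b'\<in>W. k b b' * Suc N)"
  have bound: "c b n \<le> c b' n + K" if "b \<in> W" "b' \<in> W" for b b' n
  proof -
    have "k b b' * Suc N \<le> (\<Sum>b'\<in>W. k b b' * Suc N)"
      using that fin by (intro member_le_sum) auto
    also have "\<dots> \<le> K"
      unfolding K_def using that fin by (intro member_le_sum) auto
    finally show ?thesis using le_iter[of b n "k b b'"] k[OF that] by simp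
  qed
  have total: "(\<Sum>b\<in>W. c b n) = n" for n
  proof -
    have "(\<Sum>b\<in>W. c b n) = card (\<Union>b\<in>W. {i. i < n \<and> w i = b})"
      unfolding c_def using fin by (subst card_UN_disjoint) auto
    also have "(\<Union>b\<in>W. {i. i < n \<and> w i = b}) = {..<n}" using w by auto
    finally show ?thesis by simp
  qed
  have "card W > 0" using fin a by (auto simp: card_gt_0_iff)
  \<comment> \<open>Comparing \<open>c a n\<close> with every \<open>c b n\<close> and summing over
    \<open>b\<close> replaces the unknown counts by their total \<open>n\<close>.\<close>
  have dev: "\<bar>real (card W) * real (c a n) - real n\<bar> \<le> real (card W * K)" for n
  proof -
    have "(\<Sum>b\<in>W. c a n) \<le> (\<Sum>b\<in>W. c b n + K)"
      by (intro sum_mono bound a)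
    then have 1: "card W * c a n \<le> n + card W * K"
      by (simp add: sum.distrib total)
    have "(\<Sum>b\<in>W. c b n) \<le> (\<Sum>b\<in>W. c a n + K)"
      by (intro sum_mono bound a)
    then have 2: "n \<le> card W * c a n + card W * K"
      by (simp add: total algebra_simps)
    show ?thesis using 1 2 unfolding of_nat_mult[symmetric] by linarith
  qed
  have "(\<lambda>n. real (c a n) / real n - 1 / real (card W)) \<longlonglongrightarrow> 0"
  proof (rule Lim_null_comparison)
    show "(\<lambda>n. real K / real n) \<longlonglongrightarrow> 0" by (rule lim_const_over_n)
    show "\<forall>\<^sub>F n in sequentially. norm (real (c a n) / real n - 1 / real (card W)) \<le> real K / real n"
    proof (rule eventually_sequentiallyI[of 1])
      \<comment> \<open>At \<open>n = 0\<close> the quotients by \<open>real n\<close> are 0 by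
        convention and the bound would fail, as \<open>1 / real (card W)\<close> remains on the
        left.\<close>
      fix n :: nat assume "1 \<le> n"
      then have "real (c a n) / real n - 1 / real (card W)
          = (real (card W) * real (c a n) - real n) / (real (card W) * real n)"
        using \<open>card W > 0\<close> by (simp add: field_simps)
      then have "norm (real (c a n) / real n - 1 / real (card W))
          = \<bar>real (card W) * real (c a n) - real n\<bar> / (real (card W) * real n)"
        by (simp add: abs_mult)
      also have "\<dots> \<le> real (card W * K) / (real (card W) * real n)"
        by (intro divide_right_mono dev) auto
      also have "\<dots> = real K / real n" using \<open>card W > 0\<close> by simp
      finally show "norm (real (c a n) / real n - 1 / real (card W)) \<le> real K / real n" .
    qed
  qed
  then show ?thesis by (simp add: c_def LIM_zero_iff)
qed

section \<open>Counting pairs of times\<close>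

text \<open>Sorting the pairs of times by their values \<open>(w i, w j)\<close> splits the set into
  disjoint rectangles, one for each admissible pair in \<open>G\<close>. A rectangle has as many
  elements as the product of two visit counts, so each contributes \<open>q * q\<close> in the
  limit.\<close>

lemma pair_frequency:
  fixes w :: "nat \<Rightarrow> 'a"
  assumes fin: "finite W" and w: "\<And>n. w n \<in> W"
    and freq: "\<And>a. a \<in> W \<Longrightarrow> (\<lambda>n. real (card {i. i < n \<and> w i = a}) / real n) \<longlonglongrightarrow> q"
  shows "(\<lambda>n. real (card {(i, j). i < n \<and> j < n \<and> P (w i) (w j)}) / (real n)\<^sup>2)
    \<longlonglongrightarrow> q\<^sup>2 * real (card {(a, b). a \<in> W \<and> b \<in> W \<and> P a b})"
proof -
  define c where "c b n = {i. i < n \<and> w i = b}" for b n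
  define G where "G = {(a, b). a \<in> W \<and> b \<in> W \<and> P a b}"
  have finG: "finite G" unfolding G_def by (rule finite_subset[of _ "W \<times> W"]) (use fin in auto)
  have eq: "card {(i, j). i < n \<and> j < n \<and> P (w i) (w j)}
      = (\<Sum>(a, b)\<in>G. card (c a n) * card (c b n))" for n
  proof -
    have "{(i, j). i < n \<and> j < n \<and> P (w i) (w j)} = (\<Union>ab\<in>G. c (fst ab) n \<times> c (snd ab) n)"
      using w by (auto simp: G_def c_def)
    moreover have "card (\<Union>ab\<in>G. c (fst ab) n \<times> c (snd ab) n)
        = (\<Sum>ab\<in>G. card (c (fst ab) n \<times> c (snd ab) n))"
      using finG by (intro card_UN_disjoint) (auto simp: c_def)
    ultimately show ?thesis by (simp add: case_prod_beta card_cartesian_product)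
  qed
  have "(\<lambda>n. \<Sum>(a, b)\<in>G. (real (card (c a n)) / real n) * (real (card (c b n)) / real n))
      \<longlonglongrightarrow> (\<Sum>(a, b)\<in>G. q * q)"
    unfolding case_prod_beta
    by (intro tendsto_sum tendsto_mult) (use freq in \<open>auto simp: G_def c_def\<close>)
  then show ?thesis
    by (simp add: eq case_prod_beta sum_divide_distrib power2_eq_square G_def[symmetric] mult.commute)
qed

text \<open>The two relations can differ only on the strips \<open>i < N\<close> and
  \<open>j < N\<close>, which hold at most \<open>2 * N * n\<close> pairs, negligible against the
  square of \<open>n\<close>.\<close>

lemma pair_frequency_cong:
  fixes P Q :: "nat \<Rightarrow> nat \<Rightarrow> bool"
  assumes agree: "\<And>i j. i \<ge> N \<Longrightarrow> j \<ge> N \<Longrightarrow> P i j \<longleftrightarrow> Q i j"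
    and lim: "(\<lambda>n. real (card {(i, j). i < n \<and> j < n \<and> Q i j}) / (real n)\<^sup>2) \<longlonglongrightarrow> l"
  shows "(\<lambda>n. real (card {(i, j). i < n \<and> j < n \<and> P i j}) / (real n)\<^sup>2) \<longlonglongrightarrow> l"
proof -
  define p where "p R n = card {(i, j). i < n \<and> j < n \<and> R i j}"
    for R :: "nat \<Rightarrow> nat \<Rightarrow> bool" and n
  have le: "p R n \<le> p R' n + 2 * N * n"
    if "\<And>i j. i \<ge> N \<Longrightarrow> j \<ge> N \<Longrightarrow> R i j \<longleftrightarrow> R' i j" for R R' n
  proof -
    let ?E = "{..<N} \<times> {..<n} \<union> {..<n} \<times> {..<N}"
    let ?A = "{(i, j). i < n \<and> j < n \<and> R' i j}"
    have finA: "finite ?A" by (rule finite_subset[of _ "{..<n} \<times> {..<n}"]) auto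
    have "{(i, j). i < n \<and> j < n \<and> R i j} \<subseteq> ?A \<union> ?E"
      using that by (auto simp: not_less)
    then have "p R n \<le> card (?A \<union> ?E)"
      unfolding p_def using finA by (intro card_mono) auto
    also have "\<dots> \<le> card ?A + card ?E" by (rule card_Un_le)
    also have "card ?E \<le> card ({..<N} \<times> {..<n}) + card ({..<n} \<times> {..<N})" by (rule card_Un_le)
    finally show ?thesis by (simp add: p_def mult_ac)
  qed
  have "(\<lambda>n. real (p P n) / (real n)\<^sup>2 - real (p Q n) / (real n)\<^sup>2) \<longlonglongrightarrow> 0"
  proof (rule Lim_null_comparison)
    show "(\<lambda>n. real (2 * N) / real n) \<longlonglongrightarrow> 0" by (rule lim_const_over_n)
    show "\<forall>\<^sub>F n in sequentially.
        norm (real (p P n) / (real n)\<^sup>2 - real (p Q n) / (real n)\<^sup>2) \<le> real (2 * N) / real n"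
    proof (rule always_eventually, rule allI)
      \<comment> \<open>The bound holds for every \<open>n\<close>: at \<open>n = 0\<close> all
        quotients are 0 by convention.\<close>
      fix n
      have "\<bar>real (p P n) - real (p Q n)\<bar> \<le> real (2 * N * n)"
        using le[of P Q n, OF agree] le[of Q P n, OF agree[symmetric]] by linarith
      then have "\<bar>real (p P n) - real (p Q n)\<bar> / (real n)\<^sup>2 \<le> real (2 * N * n) / (real n)\<^sup>2"
        by (rule divide_right_mono) simp
      then show "norm (real (p P n) / (real n)\<^sup>2 - real (p Q n) / (real n)\<^sup>2) \<le> real (2 * N) / real n"
        by (simp add: diff_divide_distrib[symmetric] power2_eq_square split: if_splits)
    qed
  qed
  from tendsto_add[OF this lim[folded p_def]] show ?thesis by (simp add: p_def)
qed

section \<open>Continuity of the Bowen metric\<close>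

text \<open>Equality of the topologies makes \<open>\<rho>\<close>-balls relatively open, so
  convergence in the metric of the type implies convergence in \<open>\<rho>\<close>. A metric is
  continuous for its own convergence. This lets \<open>dist\<close> serve for all estimates on the
  orbit.\<close>

lemma continuous_on_compatible_metric:
  fixes \<rho> :: "'a::metric_space \<Rightarrow> 'a \<Rightarrow> real"
  assumes metric: "Metric_space S \<rho>"
    and compatible: "Metric_space.mtopology S \<rho> = top_of_set S"
  shows "continuous_on (S \<times> S) (\<lambda>(a, b). \<rho> a b)"
proof -
  interpret Metric_space S \<rho> by fact
  have near: "(\<lambda>n. \<rho> (u n) a) \<longlonglongrightarrow> 0" if "u \<longlonglongrightarrow> a" "\<And>n. u n \<in> S" "a \<in> S" for u :: "nat \<Rightarrow> 'a" and a
  proof (rule tendstoI)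
    fix e :: real assume "e > 0"
    have "openin (top_of_set S) (mball a e)"
      unfolding compatible[symmetric] by (rule openin_mball)
    then obtain T where T: "open T" "mball a e = S \<inter> T" by (auto simp: openin_open)
    then have "a \<in> T" using \<open>e > 0\<close> \<open>a \<in> S\<close> by (auto dest: equalityD1)
    from topological_tendstoD[OF that(1) T(1) this]
    show "\<forall>\<^sub>F n in sequentially. dist (\<rho> (u n) a) 0 < e"
    proof eventually_elim
      case (elim n)
      then have "u n \<in> mball a e" using T(2) that(2) by auto
      then show ?case by (simp add: commute)
    qed
  qed
  show ?thesis
    unfolding continuous_on_sequentially o_def
  proof (intro allI ballI impI)
    fix u :: "nat \<Rightarrow> 'a \<times> 'a" and ab
    assume "ab \<in> S \<times> S" and u: "(\<forall>n. u n \<in> S \<times> S) \<and> u \<longlonglongrightarrow> ab"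
    then obtain a b where ab: "ab = (a, b)" "a \<in> S" "b \<in> S" by auto
    have in_S: "fst (u n) \<in> S" "snd (u n) \<in> S" for n using u by (auto simp: mem_Times_iff)
    have "(\<lambda>n. \<rho> (fst (u n)) a) \<longlonglongrightarrow> 0" "(\<lambda>n. \<rho> (snd (u n)) b) \<longlonglongrightarrow> 0"
      using tendsto_fst[OF u[THEN conjunct2]] tendsto_snd[OF u[THEN conjunct2]] ab in_S
      by (auto intro!: near)
    then have "(\<lambda>n. \<rho> (fst (u n)) a + \<rho> (snd (u n)) b) \<longlonglongrightarrow> 0"
      using tendsto_add by fastforce
    \<comment> \<open>The quadrilateral inequality, with two triangle inequalities for each
      sign.\<close>
    moreover have "norm (\<rho> (fst (u n)) (snd (u n)) - \<rho> a b) \<le> \<rho> (fst (u n)) a + \<rho> (snd (u n)) b" for n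
      using triangle[OF in_S(1)[of n] ab(2) in_S(2)[of n]] triangle[OF ab(2,3) in_S(2)[of n]]
        triangle[OF ab(2) in_S(1)[of n] ab(3)] triangle[OF in_S(1)[of n] in_S(2)[of n] ab(3)]
      by (simp add: commute abs_le_iff)
    ultimately have "(\<lambda>n. \<rho> (fst (u n)) (snd (u n)) - \<rho> a b) \<longlonglongrightarrow> 0"
      by (rule Lim_null_comparison[OF always_eventually, OF allI, rotated])
    then show "(\<lambda>n. case u n of (a, b) \<Rightarrow> \<rho> a b) \<longlonglongrightarrow> (case ab of (a, b) \<Rightarrow> \<rho> a b)"
      by (simp add: case_prod_beta ab(1) LIM_zero_iff)
  qed
qed

lemma continuous_on_funpow:
  assumes "continuous_on S f" "f \<in> S \<rightarrow> S"
  shows "continuous_on S (f ^^ n)"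
proof (induction n)
  case (Suc n)
  have "(f ^^ n) ` S \<subseteq> S" using funpow_in[OF assms(2)] by blast
  then have "continuous_on ((f ^^ n) ` S) f" using assms(1) continuous_on_subset by blast
  then show ?case using continuous_on_compose[OF Suc] by simp
qed (simp add: id_def)

text \<open>Passing from \<open>k\<close> to \<open>Suc k\<close> takes a binary maximum with one
  more continuous term. The induction starts at 1 because this splitting of \<open>Max\<close>
  requires a nonempty family.\<close>

lemma continuous_on_bowen_metric:
  fixes \<rho> :: "'a::metric_space \<Rightarrow> 'a \<Rightarrow> real"
  assumes cont\<rho>: "continuous_on (S \<times> S) (\<lambda>(a, b). \<rho> a b)"
    and f: "continuous_on S f" "f \<in> S \<rightarrow> S" and m: "1 \<le> m"
  shows "continuous_on (S \<times> S) (\<lambda>(a, b). bowen_metric \<rho> f m a b)"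
  using m
proof (induction m rule: dec_induct)
  have coord: "continuous_on (S \<times> S) (\<lambda>p. \<rho> ((f ^^ i) (fst p)) ((f ^^ i) (snd p)))" for i
  proof -
    have "continuous_on (S \<times> S) (\<lambda>p. ((f ^^ i) (fst p), (f ^^ i) (snd p)))"
      by (intro continuous_on_Pair continuous_on_compose2[OF continuous_on_funpow[OF f]]
          continuous_on_fst continuous_on_snd continuous_on_id) auto
    moreover have "(\<lambda>p. ((f ^^ i) (fst p), (f ^^ i) (snd p))) ` (S \<times> S) \<subseteq> S \<times> S"
      using funpow_in[OF f(2)] by auto
    ultimately have "continuous_on (S \<times> S) (\<lambda>p. case ((f ^^ i) (fst p), (f ^^ i) (snd p)) of (a, b) \<Rightarrow> \<rho> a b)"
      by (rule continuous_on_compose2[OF cont\<rho>])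
    then show ?thesis by simp
  qed
  {
    case base
    have "bowen_metric \<rho> f 1 a b = \<rho> a b" for a b
      by (simp add: bowen_metric_def)
    then show ?case using coord[of 0] by (simp add: case_prod_beta)
  next
    case (step k)
    have "bowen_metric \<rho> f (Suc k) a b
        = max (\<rho> ((f ^^ k) a) ((f ^^ k) b)) (bowen_metric \<rho> f k a b)" for a b
    proof -
      have "{\<rho> ((f ^^ i) a) ((f ^^ i) b) | i. i < Suc k}
          = insert (\<rho> ((f ^^ k) a) ((f ^^ k) b)) {\<rho> ((f ^^ i) a) ((f ^^ i) b) | i. i < k}"
        by (auto simp: less_Suc_eq)
      moreover have "{\<rho> ((f ^^ i) a) ((f ^^ i) b) | i. i < k} \<noteq> {}" using step.hyps by (auto intro: exI[of _ 0])
      ultimately show ?thesis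
        unfolding bowen_metric_def by (simp add: Max_insert)
    qed
    then show ?case
      using continuous_on_max[OF coord[of k] step.IH[unfolded case_prod_beta]]
      by (simp add: case_prod_beta)
  }
qed

section \<open>Stability of the threshold and the limit of the correlation sums\<close>

text \<open>The finitely many values of \<open>D\<close> on \<open>W\<close> avoid
  \<open>\<epsilon>\<close>, hence keep a distance \<open>d > 0\<close> from it. Once
  \<open>D (u i) (u j)\<close> is closer than \<open>d\<close> to \<open>D (w i) (w j)\<close>, both
  lie on the same side of \<open>\<epsilon>\<close>.\<close>

lemma threshold_agree:
  fixes D :: "'a::metric_space \<Rightarrow> 'a \<Rightarrow> real"
  assumes D: "uniformly_continuous_on (S \<times> S) (\<lambda>(a, b). D a b)"
    and u: "\<And>n. u n \<in> S" and fin: "finite W" and WS: "W \<subseteq> S" and w: "\<And>n. w n \<in> W"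
    and lim: "(\<lambda>n. dist (u n) (w n)) \<longlonglongrightarrow> 0"
    and \<epsilon>: "\<epsilon> \<notin> {D a b | a b. a \<in> W \<and> b \<in> W}"
  obtains N where "\<And>i j. i \<ge> N \<Longrightarrow> j \<ge> N \<Longrightarrow> D (u i) (u j) \<le> \<epsilon> \<longleftrightarrow> D (w i) (w j) \<le> \<epsilon>"
proof -
  have finD: "finite {D a b | a b. a \<in> W \<and> b \<in> W}"
    by (rule finite_image_set2) (simp_all add: fin)
  then obtain d where d: "d > 0" "\<And>t. t \<in> {D a b | a b. a \<in> W \<and> b \<in> W} \<Longrightarrow> t \<noteq> \<epsilon> \<Longrightarrow> d \<le> dist \<epsilon> t"
    using finite_set_avoid[OF finD, of \<epsilon>] by blast
  obtain \<delta> where \<delta>: "\<delta> > 0"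
    "\<And>p p'. p \<in> S \<times> S \<Longrightarrow> p' \<in> S \<times> S \<Longrightarrow> dist p' p < \<delta>
      \<Longrightarrow> dist (case p' of (a, b) \<Rightarrow> D a b) (case p of (a, b) \<Rightarrow> D a b) < d"
    using uniformly_continuous_onE[OF D d(1)] by blast
  \<comment> \<open>Half of \<open>\<delta>\<close> for each coordinate, since the product distance
    is at most the sum of the coordinate distances.\<close>
  have "\<forall>\<^sub>F n in sequentially. dist (u n) (w n) < \<delta> / 2"
    using \<delta>(1) by (intro order_tendstoD(2)[OF lim]) simp
  then obtain N where N: "\<And>n. n \<ge> N \<Longrightarrow> dist (u n) (w n) < \<delta> / 2"
    by (auto simp: eventually_sequentially)
  show thesis
  proof (rule that)
    fix i j assume ij: "i \<ge> N" "j \<ge> N"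
    have "dist (u i, u j) (w i, w j) \<le> dist (u i) (w i) + dist (u j) (w j)"
      by (simp add: dist_Pair_Pair sqrt_sum_squares_le_sum)
    also have "\<dots> < \<delta>" using N[OF ij(1)] N[OF ij(2)] by linarith
    finally have "dist (D (u i) (u j)) (D (w i) (w j)) < d"
      using \<delta>(2)[of "(w i, w j)" "(u i, u j)"] u w WS by auto
    moreover have "d \<le> dist \<epsilon> (D (w i) (w j))"
      using w \<epsilon> by (intro d(2)) auto
    ultimately show "D (u i) (u j) \<le> \<epsilon> \<longleftrightarrow> D (w i) (w j) \<le> \<epsilon>"
      by (auto simp: dist_real_def)
  qed
qed

text \<open>Comparisons along the orbit agree with those along the tracking sequence from some time
  on, and the latter are counted by visit frequencies, all equal to the reciprocal of the number of
  limit points.\<close>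

lemma corr_sum_tendsto:
  fixes \<rho> :: "'a::metric_space \<Rightarrow> 'a \<Rightarrow> real"
  assumes S: "compact S" "continuous_on S f" "f \<in> S \<rightarrow> S" "x \<in> S"
    and metric: "Metric_space S \<rho>"
    and compatible: "Metric_space.mtopology S \<rho> = top_of_set S"
    and fin: "finite (omega_limit f x)" and m: "1 \<le> m"
    and \<epsilon>: "\<epsilon> \<notin> {bowen_metric \<rho> f m a b | a b. a \<in> omega_limit f x \<and> b \<in> omega_limit f x}"
  shows "(\<lambda>n. corr_sum \<rho> f m x n \<epsilon>) \<longlonglongrightarrow> 1 / (real (card (omega_limit f x)))\<^sup>2 *
    real (card {(a, b). a \<in> omega_limit f x \<and> b \<in> omega_limit f x \<and> bowen_metric \<rho> f m a b \<le> \<epsilon>})"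
proof -
  obtain w where w: "\<And>n. w n \<in> omega_limit f x" "(\<lambda>n. dist ((f ^^ n) x) (w n)) \<longlonglongrightarrow> 0"
    "eventually (\<lambda>n. w (Suc n) = f (w n)) sequentially"
    "\<And>a N. a \<in> omega_limit f x \<Longrightarrow> \<exists>n\<ge>N. w n = a"
    by (rule omega_limit_tracking[OF S fin]) (rule that)
  obtain M where M: "\<And>n. n \<ge> M \<Longrightarrow> w (Suc n) = f (w n)"
    using w(3) by (auto simp: eventually_sequentially)
  \<comment> \<open>Compactness of the square makes the closeness of orbit and \<open>w\<close>
    uniform over all pairs of late times.\<close>
  have "uniformly_continuous_on (S \<times> S) (\<lambda>(a, b). bowen_metric \<rho> f m a b)"
    by (intro compact_uniformly_continuous compact_Times S continuous_on_bowen_metric m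
        continuous_on_compatible_metric metric compatible)
  then obtain N where N: "\<And>i j. i \<ge> N \<Longrightarrow> j \<ge> N \<Longrightarrow>
      bowen_metric \<rho> f m ((f ^^ i) x) ((f ^^ j) x) \<le> \<epsilon> \<longleftrightarrow> bowen_metric \<rho> f m (w i) (w j) \<le> \<epsilon>"
    by (rule threshold_agree[OF _ funpow_in[OF S(3,4)] fin
          omega_limit_subset[OF compact_imp_closed[OF S(1)] S(3,4)] w(1,2) \<epsilon>])
      (rule that)
  have "(\<lambda>n. real (card {(i, j). i < n \<and> j < n \<and> bowen_metric \<rho> f m (w i) (w j) \<le> \<epsilon>}) / (real n)\<^sup>2)
    \<longlonglongrightarrow> (1 / real (card (omega_limit f x)))\<^sup>2 *
      real (card {(a, b). a \<in> omega_limit f x \<and> b \<in> omega_limit f x \<and> bowen_metric \<rho> f m a b \<le> \<epsilon>})"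
    by (rule pair_frequency[OF fin w(1)], rule visit_frequency[OF fin w(1) M w(4)])
  then have "(\<lambda>n. real (card {(i, j). i < n \<and> j < n
        \<and> bowen_metric \<rho> f m ((f ^^ i) x) ((f ^^ j) x) \<le> \<epsilon>}) / (real n)\<^sup>2)
    \<longlonglongrightarrow> (1 / real (card (omega_limit f x)))\<^sup>2 *
      real (card {(a, b). a \<in> omega_limit f x \<and> b \<in> omega_limit f x \<and> bowen_metric \<rho> f m a b \<le> \<epsilon>})"
    by (rule pair_frequency_cong[where N = N
          and Q = "\<lambda>i j. bowen_metric \<rho> f m (w i) (w j) \<le> \<epsilon>", rotated]) (rule N)
  then show ?thesis
    by (simp add: corr_sum_def power_one_over)
qed

theorem theorem8:
  fixes \<rho> :: "real \<Rightarrow> real \<Rightarrow> real" and f :: "real \<Rightarrow> real" and x :: real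
  assumes metric: "Metric_space {0..1} \<rho>"
    and compatible: "Metric_space.mtopology {0..1} \<rho> = top_of_set {0..1}"
    and cont: "continuous_on {0..1} f"
    and self_map: "f \<in> {0..1} \<rightarrow> {0..1}"
    and x: "x \<in> {0..1}"
    and fin: "finite (omega_limit f x)"
  shows "(\<forall>m::nat. 1 \<le> m \<longrightarrow>
            finite {\<epsilon>::real. 0 < \<epsilon> \<and> lower_corr \<rho> f m x \<epsilon> \<noteq> upper_corr \<rho> f m x \<epsilon>})
       \<and> (\<forall>(m::nat) (p::nat) (y::nat \<Rightarrow> real) (\<epsilon>::real).
            1 \<le> m \<longrightarrow>
            omega_limit f x = y ` {..<p} \<longrightarrow>
            card (omega_limit f x) = p \<longrightarrow>
            0 < \<epsilon> \<longrightarrow>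
            \<epsilon> \<notin> {bowen_metric \<rho> f m (y i) (y j) | i j. i < p \<and> j < p} \<longrightarrow>
            (\<lambda>n. corr_sum \<rho> f m x n \<epsilon>) \<longlonglongrightarrow>
              1 / (real p)\<^sup>2 *
              real (card {(i, j). i < p \<and> j < p \<and> bowen_metric \<rho> f m (y i) (y j) \<le> \<epsilon>}))"
proof (intro conjI allI impI)
  let ?W = "omega_limit f x"
  note lim = corr_sum_tendsto[OF compact_Icc cont self_map x metric compatible fin]
  fix m :: nat assume m: "1 \<le> m"
  let ?D = "{bowen_metric \<rho> f m a b | a b. a \<in> ?W \<and> b \<in> ?W}"
  {
    \<comment> \<open>Outside \<open>?D\<close> the correlation sums converge, so the exceptional
      values of \<open>\<epsilon>\<close> all lie in this finite set.\<close>
    have "finite ?D"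
      by (rule finite_image_set2) (simp_all add: fin)
    moreover have "lower_corr \<rho> f m x \<epsilon> = upper_corr \<rho> f m x \<epsilon>" if "\<epsilon> \<notin> ?D" for \<epsilon>
    proof -
      have L: "(\<lambda>n. ereal (corr_sum \<rho> f m x n \<epsilon>)) \<longlonglongrightarrow> ereal (1 / (real (card ?W))\<^sup>2 *
          real (card {(a, b). a \<in> ?W \<and> b \<in> ?W \<and> bowen_metric \<rho> f m a b \<le> \<epsilon>}))"
        by (rule tendsto_ereal[OF lim[OF m that]])
      show ?thesis
        unfolding lower_corr_def upper_corr_def
        by (simp only: lim_imp_Liminf[OF sequentially_bot L] lim_imp_Limsup[OF sequentially_bot L])
    qed
    ultimately show "finite {\<epsilon>. 0 < \<epsilon> \<and> lower_corr \<rho> f m x \<epsilon> \<noteq> upper_corr \<rho> f m x \<epsilon>}"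
      by (elim finite_subset[rotated]) blast
  next
    fix p :: nat and y :: "nat \<Rightarrow> real" and \<epsilon> :: real
    assume y: "?W = y ` {..<p}" and p: "card ?W = p"
      and \<epsilon>: "\<epsilon> \<notin> {bowen_metric \<rho> f m (y i) (y j) | i j. i < p \<and> j < p}"
    have notin: "\<epsilon> \<notin> ?D" using \<epsilon> unfolding y by auto
    \<comment> \<open>An enumeration of \<open>p\<close> points by \<open>p\<close> indices has no
      repetitions, so pairs of limit points can be counted as pairs of indices.\<close>
    have inj: "inj_on y {..<p}" using p by (intro eq_card_imp_inj_on) (simp_all add: y[symmetric])
    have "{(a, b). a \<in> ?W \<and> b \<in> ?W \<and> bowen_metric \<rho> f m a b \<le> \<epsilon>}
        = map_prod y y ` {(i, j). i < p \<and> j < p \<and> bowen_metric \<rho> f m (y i) (y j) \<le> \<epsilon>}"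
      unfolding y by force
    moreover have "inj_on (map_prod y y)
        {(i, j). i < p \<and> j < p \<and> bowen_metric \<rho> f m (y i) (y j) \<le> \<epsilon>}"
      by (rule inj_on_subset[OF map_prod_inj_on[OF inj inj]]) auto
    ultimately show "(\<lambda>n. corr_sum \<rho> f m x n \<epsilon>) \<longlonglongrightarrow> 1 / (real p)\<^sup>2 *
        real (card {(i, j). i < p \<and> j < p \<and> bowen_metric \<rho> f m (y i) (y j) \<le> \<epsilon>})"
      using lim[OF m notin] by (simp add: card_image p)
  }
qed

end
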